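(* Let $m$ be a positive integer. For all integers $n,k\ge0$ we have \[ \mathrm{rpc}_+^k(n,m)=\sum_{2i+mj+2c+(m-1)r+s=n-k}(-1)^r\binom{i}{k}\binom{i+j-1}{j}\binom{i+c}{c}\binom{k}{r}\binom{k+s-1}{s} \] and \[ \mathrm{rpc}_+^k(n,m)=\sum_{\substack{i_0+i_1+\cdots+i_{m-2}=k\\ 2i+mj+2c+i_1+2i_2+\cdots+(m-2)i_{m-2}=n-k}}\binom{i}{k}\binom{i+j-1}{j}\binom{i+c}{c}\binom{k}{i_0,i_1,\ldots,i_{m-2}}. \]
   Context: A composition of $n$ is a finite sequence $\alpha=(\alpha_1,\ldots,\alpha_\ell)$ of positive integers with $\alpha_1+\cdots+\alpha_\ell=n$; the empty sequence ($\ell=0$) is the only composition of $0$. Two compositions of the same length $\ell$ are called equivalent if one is obtained from the other by a sequence of swaps, each swap exchanging the $i$th part and the $(\ell+1-i)$th part for some $1\le i\le\ell/2$. The number $\mathrm{rpc}_+^k(n,m)$ is the number of equivalence classes of compositions $\alpha=(\alpha_1,\ldots,\alpha_\ell)$ of $n$ such that $\#\{1\le i\le \ell/2:\alpha_i\not\equiv\alpha_{\ell+1-i}\pmod m\}=k$ and either $\ell$ is even, or $\ell$ is odd and the middle part $\alpha_{(\ell+1)/2}$ is even. Convention for binomial coefficients, for integers $a,b$: $\binom{a}{b}=\frac{a!}{b!(a-b)!}$ if $a\ge b\ge1$; $\binom{a}{b}=1$ if $b=0$ (for every integer $a$, including $a=-1$); $\binom{a}{b}=0$ otherwise. $\binom{k}{i_0,\ldots,i_{m-2}}=\frac{k!}{i_0!\cdots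 i_{m-2}!}$ is the multinomial coefficient. All summation indices (including $i_0,\ldots,i_{m-2}$) range over nonnegative integers; only finitely many terms are nonzero. When $m=1$ the list $i_0,\ldots,i_{m-2}$ is empty with empty sum $0$, so the second sum is empty unless $k=0$, in which case the multinomial coefficient is $1$. *)

theory Defs
  imports "HOL-Library.Groups_Big_Fun"
begin

definition compositions :: "nat \<Rightarrow> nat list set" where
  "compositions n = {\<alpha>. (\<forall>a\<in>set \<alpha>. a > 0) \<and> sum_list \<alpha> = n}"

(* Parts are numbered from 1 in the mathematics. *)
definition part :: "nat list \<Rightarrow> nat \<Rightarrow> nat" where
  "part \<alpha> i = \<alpha> ! (i - 1)"

definition swap_parts :: "nat \<Rightarrow> nat list \<Rightarrow> nat list" where
  "swap_parts i \<alpha> =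
     (let l = length \<alpha>
      in \<alpha>[i - 1 := part \<alpha> (l + 1 - i), l + 1 - i - 1 := part \<alpha> i])"

definition swap_step :: "(nat list \<times> nat list) set" where
  "swap_step = {(\<alpha>, swap_parts i \<alpha>) | \<alpha> i. 1 \<le> i \<and> 2 * i \<le> length \<alpha>}"

definition swap_equiv :: "(nat list \<times> nat list) set" where
  "swap_equiv = swap_step\<^sup>*"

definition num_incongruent_pairs :: "nat \<Rightarrow> nat list \<Rightarrow> nat" where
  "num_incongruent_pairs m \<alpha> =
     card {i. 1 \<le> i \<and> 2 * i \<le> length \<alpha> \<and>
              part \<alpha> i mod m \<noteq> part \<alpha> (length \<alpha> + 1 - i) mod m}"

definition rpc_plus :: "nat \<Rightarrow> nat \<Rightarrow> nat \<Rightarrow> nat" where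
  "rpc_plus k n m =
     card ({\<alpha> \<in> compositions n.
              num_incongruent_pairs m \<alpha> = k \<and>
              (even (length \<alpha>) \<or>
               odd (length \<alpha>) \<and> even (part \<alpha> ((length \<alpha> + 1) div 2)))}
           // swap_equiv)"

(* Equal to 1 at b = 0 for every integer a, in particular a = -1, and 0 whenever a < b with
   b >= 1; this differs from gchoose, where for instance (-1) gchoose 1 = -1. *)
definition ibinom :: "int \<Rightarrow> int \<Rightarrow> int" where
  "ibinom a b =
     (if a \<ge> b \<and> b \<ge> 1 then int (nat a choose nat b) else if b = 0 then 1 else 0)"

(* The division is exact when sum_list is = k, the only case in which it is used. *)
definition multinomial :: "nat \<Rightarrow> nat list \<Rightarrow> nat" where
  "multinomial k is = fact k div (\<Prod>x\<leftarrow>is. fact x)"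

end

theory Submission
  imports Defs "HOL-Computational_Algebra.Formal_Power_Series"
begin

text \<open>
  A composition is determined up to the allowed swaps by the unordered pairs
  \<open>{\<alpha>\<^sub>i, \<alpha>\<^sub>\<ell>\<^sub>+\<^sub>1\<^sub>-\<^sub>i}\<close>, listed from the outside inwards, and by its middle part. Writing an
  unordered pair as \<open>{b, b + d}\<close> with \<open>b \<ge> 1\<close> and \<open>d \<ge> 0\<close>, its two parts are congruent modulo \<open>m\<close>
  exactly when \<open>m\<close> divides \<open>d\<close>. Hence \<open>rpc_plus\<close> counts sequences of pairs \<open>(b, d)\<close>, of which
  exactly \<open>k\<close> have \<open>m\<close> not dividing \<open>d\<close>, together with an even number \<open>2 c\<close>, the middle part or 0
  if there is none (lemma \<open>rpc_plus_eq_card_fold_forms\<close>).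

  Such sequences are counted by generating functions. A congruent pair is \<open>(u + 1, m q)\<close>, which
  contributes \<open>C = X\<^sup>2 / ((1 - X\<^sup>2) (1 - X\<^sup>m))\<close>. An incongruent pair is \<open>(u + 1, m q + t + 1)\<close> with
  \<open>t < m - 1\<close>, which contributes \<open>X U C\<close> with \<open>U = 1 + X + \<dots> + X\<^sup>m\<^sup>-\<^sup>2\<close>. Choosing which \<open>k\<close> of \<open>i\<close> pairs
  are incongruent, and multiplying by \<open>1 / (1 - X\<^sup>2)\<close> for the middle part, sequences of \<open>i\<close> pairs
  have the generating function

  \<open>(i choose k) X\<^sup>2\<^sup>i\<^sup>+\<^sup>k (1 - X\<^sup>m)\<^sup>-\<^sup>i (1 - X\<^sup>2)\<^sup>-\<^sup>(\<^sup>i\<^sup>+\<^sup>1\<^sup>) U\<^sup>k\<close>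

  (lemmas \<open>pair_lists_gf\<close> and \<open>rpc_plus_eq_coeffs\<close>). The negative powers are binomial series in the
  summation indices \<open>j\<close> and \<open>c\<close>, and the two formulas differ only in how \<open>U\<^sup>k\<close> is expanded:
  as \<open>(1 - X\<^sup>m\<^sup>-\<^sup>1)\<^sup>k (1 - X)\<^sup>-\<^sup>k\<close>, giving the indices \<open>r\<close> and \<open>s\<close>, or by the multinomial theorem, giving
  the indices \<open>i\<^sub>0, i\<^sub>1, \<dots>\<close>. Lemma \<open>rpc_plus_eq_Sum_any\<close> therefore takes an arbitrary expansion
  of \<open>U\<^sup>k\<close>.
\<close>

section \<open>Generating functions of weighted sets\<close>

text \<open>The sum over a fibre \<open>{s \<in> S. w s = n}\<close> is silently 0 if the fibre is infinite, so \<open>gf S f w\<close> is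
  the series \<open>\<Sum>s\<in>S. f s X^(w s)\<close> only for weights with finite fibres.\<close>

definition finite_fibres :: "'a set \<Rightarrow> ('a \<Rightarrow> nat) \<Rightarrow> bool" where
  "finite_fibres S w \<longleftrightarrow> (\<forall>n. finite {s \<in> S. w s = n})"

definition gf :: "'a set \<Rightarrow> ('a \<Rightarrow> int) \<Rightarrow> ('a \<Rightarrow> nat) \<Rightarrow> int fps" where
  "gf S f w = Abs_fps (\<lambda>n. \<Sum>s \<in> {s \<in> S. w s = n}. f s)"

lemma gf_nth: "fps_nth (gf S f w) n = (\<Sum>s \<in> {s \<in> S. w s = n}. f s)"
  by (simp add: gf_def)

lemma finite_fibres_finite: "finite S \<Longrightarrow> finite_fibres S w"
  by (simp add: finite_fibres_def)

lemma finite_fibres_Times: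
  assumes "finite_fibres S w" "finite_fibres T v"
  shows "finite_fibres (S \<times> T) (\<lambda>(s, t). w s + v t)"
  unfolding finite_fibres_def
proof
  fix n
  have "{p \<in> S \<times> T. (case p of (s, t) \<Rightarrow> w s + v t) = n}
      \<subseteq> (\<Union>a\<in>{..n}. {s \<in> S. w s = a} \<times> {t \<in> T. v t = n - a})"
    by auto
  then show "finite {p \<in> S \<times> T. (case p of (s, t) \<Rightarrow> w s + v t) = n}"
    by (rule finite_subset) (use assms in \<open>auto simp: finite_fibres_def\<close>)
qed

text \<open>Weights add and coefficients multiply on a product of sets because the fibre over \<open>n\<close> is the
  disjoint union of the products of the fibres over \<open>a\<close> and \<open>n - a\<close>. The lemma serves both to
  multiply counting series and to read off the coefficients of a product as a multiple sum.\<close>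

lemma gf_Times:
  assumes "finite_fibres S w" "finite_fibres T v"
  shows "gf (S \<times> T) (\<lambda>(s, t). f s * g t) (\<lambda>(s, t). w s + v t) = gf S f w * gf T g v"
proof (rule fps_ext)
  fix n
  let ?S = "\<lambda>a. {s \<in> S. w s = a}" and ?T = "\<lambda>a. {t \<in> T. v t = a}"
  have fin: "finite (?S a)" "finite (?T a)" for a
    using assms by (auto simp: finite_fibres_def)
  have "{p \<in> S \<times> T. (case p of (s, t) \<Rightarrow> w s + v t) = n}
      = (\<Union>a\<in>{0..n}. ?S a \<times> ?T (n - a))"
    by auto
  then have "fps_nth (gf (S \<times> T) (\<lambda>(s, t). f s * g t) (\<lambda>(s, t). w s + v t)) n
      = (\<Sum>a=0..n. \<Sum>p\<in>?S a \<times> ?T (n - a). case p of (s, t) \<Rightarrow> f s * g t)"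
    unfolding gf_nth using fin by (simp only:) (rule sum.UNION_disjoint, auto)
  also have "\<dots> = (\<Sum>a=0..n. fps_nth (gf S f w) a * fps_nth (gf T g v) (n - a))"
    unfolding gf_nth by (simp add: sum_product sum.cartesian_product)
  finally show "fps_nth (gf (S \<times> T) (\<lambda>(s, t). f s * g t) (\<lambda>(s, t). w s + v t)) n
      = fps_nth (gf S f w * gf T g v) n"
    by (simp add: fps_mult_nth)
qed

lemma finite_fibres_reindex:
  assumes "bij_betw h T S" "\<And>t. t \<in> T \<Longrightarrow> w (h t) = v t" "finite_fibres T v"
  shows "finite_fibres S w"
  unfolding finite_fibres_def
proof
  fix n
  have "{s \<in> S. w s = n} = h ` {t \<in> T. v t = n}"
    using assms(1,2) by (auto simp: bij_betw_def)
  then show "finite {s \<in> S. w s = n}"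
    using assms(3) by (simp add: finite_fibres_def)
qed

lemma gf_reindex:
  assumes "bij_betw h T S" "\<And>t. t \<in> T \<Longrightarrow> w (h t) = v t" "\<And>t. t \<in> T \<Longrightarrow> f (h t) = g t"
  shows "gf S f w = gf T g v"
proof (rule fps_ext)
  fix n
  have "bij_betw h {t \<in> T. v t = n} {s \<in> S. w s = n}"
    using assms(1,2) by (auto simp: bij_betw_def inj_on_def)
  then have "(\<Sum>t\<in>{t \<in> T. v t = n}. f (h t)) = (\<Sum>s\<in>{s \<in> S. w s = n}. f s)"
    by (rule sum.reindex_bij_betw)
  then show "fps_nth (gf S f w) n = fps_nth (gf T g v) n"
    using assms(3) by (simp add: gf_nth)
qed

lemma finite_fibres_Un:
  "finite_fibres S w \<Longrightarrow> finite_fibres T w \<Longrightarrow> finite_fibres (S \<union> T) w"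
  by (auto simp: finite_fibres_def Collect_disj_eq conj_disj_distribR)

lemma gf_Un:
  assumes "finite_fibres S w" "finite_fibres T w" "S \<inter> T = {}"
  shows "gf (S \<union> T) f w = gf S f w + gf T f w"
proof (rule fps_ext)
  fix n
  have "{s \<in> S \<union> T. w s = n} = {s \<in> S. w s = n} \<union> {s \<in> T. w s = n}" by auto
  then show "fps_nth (gf (S \<union> T) f w) n = fps_nth (gf S f w + gf T f w) n"
    using assms by (auto simp: gf_nth finite_fibres_def intro!: sum.union_disjoint)
qed

lemma gf_finite:
  assumes "finite S"
  shows "gf S f w = (\<Sum>s\<in>S. fps_const (f s) * fps_X ^ w s)"
proof (rule fps_ext)
  fix n
  have "(\<Sum>s\<in>{s \<in> S. w s = n}. f s) = (\<Sum>s\<in>S. if w s = n then f s else 0)"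
    using assms by (simp add: sum.inter_filter)
  then show "fps_nth (gf S f w) n = fps_nth (\<Sum>s\<in>S. fps_const (f s) * fps_X ^ w s) n"
    by (auto simp: gf_nth fps_sum_nth fps_X_power_nth intro!: sum.cong)
qed

lemma gf_shift: "gf S f (\<lambda>s. w s + c) = fps_X ^ c * gf S f w"
proof (rule fps_ext)
  fix n
  have "{s \<in> S. w s + c = n} = (if n < c then {} else {s \<in> S. w s = n - c})" by auto
  then show "fps_nth (gf S f (\<lambda>s. w s + c)) n = fps_nth (fps_X ^ c * gf S f w) n"
    by (simp add: gf_nth fps_X_power_mult_nth)
qed

lemma finite_fibres_shift: "finite_fibres S w \<Longrightarrow> finite_fibres S (\<lambda>s. w s + c)"
  unfolding finite_fibres_def
proof
  fix n
  assume *: "\<forall>n. finite {s \<in> S. w s = n}"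
  have "{s \<in> S. w s + c = n} \<subseteq> {s \<in> S. w s = n - c}" by auto
  then show "finite {s \<in> S. w s + c = n}" by (rule finite_subset) (use * in simp)
qed

section \<open>Geometric and negative binomial series\<close>

text \<open>The series \<open>1 / (1 - X\<^sup>M)\<close>, for \<open>M > 0\<close>.\<close>

definition geo :: "nat \<Rightarrow> int fps" where
  "geo M = gf UNIV (\<lambda>_. 1) (\<lambda>j. M * j)"

lemma finite_fibres_mult: "M > 0 \<Longrightarrow> finite_fibres (UNIV :: nat set) (\<lambda>j. M * j)"
  unfolding finite_fibres_def
proof
  fix n :: nat assume "M > 0"
  then have "{s \<in> UNIV. M * s = n} \<subseteq> {..n}" by auto
  then show "finite {s \<in> UNIV. M * s = n}" by (rule finite_subset) simp
qed

lemma gf_multiples_nth: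
  assumes "M > 0"
  shows "fps_nth (gf UNIV f (\<lambda>j. M * j)) n = (if M dvd n then f (n div M) else 0)"
proof -
  have "{s \<in> UNIV. M * s = n} = (if M dvd n then {n div M} else {})"
    using assms by auto
  then show ?thesis by (simp add: gf_nth)
qed

text \<open>Multiplication by \<open>1 - X\<^sup>M\<close> takes backward differences of the coefficients.\<close>

lemma gf_multiples_diff:
  assumes "M > 0"
  shows "(1 - fps_X ^ M) * gf UNIV f (\<lambda>j. M * j)
    = gf UNIV (\<lambda>j. f j - (if j = 0 then 0 else f (j - 1))) (\<lambda>j. M * j)"
proof (rule fps_ext)
  fix n
  have lhs: "fps_nth ((1 - fps_X ^ M) * gf UNIV f (\<lambda>j. M * j)) n
      = fps_nth (gf UNIV f (\<lambda>j. M * j)) n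
        - (if n < M then 0 else fps_nth (gf UNIV f (\<lambda>j. M * j)) (n - M))"
    by (simp only: left_diff_distrib fps_sub_nth fps_X_power_mult_nth mult_1_left)
  show "fps_nth ((1 - fps_X ^ M) * gf UNIV f (\<lambda>j. M * j)) n
     = fps_nth (gf UNIV (\<lambda>j. f j - (if j = 0 then 0 else f (j - 1))) (\<lambda>j. M * j)) n"
  proof (cases "M dvd n")
    case True
    then obtain q where q: "n = M * q" by blast
    show ?thesis
    proof (cases q)
      case 0
      then show ?thesis
        unfolding lhs gf_multiples_nth[OF assms] using assms by (simp add: q)
    next
      case (Suc p)
      then have "n - M = M * p" "\<not> n < M" by (simp_all add: q)
      then show ?thesis
        unfolding lhs gf_multiples_nth[OF assms] using assms Suc by (simp add: q)
    qed
  next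
    case False
    then have "\<not> M dvd n - M" if "\<not> n < M"
      using that by (simp add: dvd_minus_self)
    then show ?thesis
      unfolding lhs gf_multiples_nth[OF assms] using False by simp
  qed
qed

lemma gf_multiples_delta:
  assumes "M > 0"
  shows "gf UNIV (\<lambda>j. if j = 0 then 1 else 0) (\<lambda>j. M * j) = 1"
proof (rule fps_ext)
  fix n
  show "fps_nth (gf UNIV (\<lambda>j. if j = 0 then 1 else 0) (\<lambda>j. M * j)) n = fps_nth 1 n"
    unfolding gf_multiples_nth[OF assms] using assms
    by (cases "n = 0") (auto elim: dvdE)
qed

lemma geo_inverse:
  assumes "M > 0"
  shows "(1 - fps_X ^ M) * geo M = 1"
proof -
  have "(\<lambda>j::nat. 1 - (if j = 0 then 0 else 1)) = (\<lambda>j. if j = 0 then 1 else 0 :: int)"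
    by auto
  then show ?thesis
    unfolding geo_def gf_multiples_diff[OF assms] by (simp only: gf_multiples_delta[OF assms])
qed

lemma ibinom_of_nat: "ibinom (int a) (int b) = int (a choose b)"
  by (auto simp: ibinom_def)

lemma ibinom_pred:
  "ibinom (int i + int j - 1) (int j) = (if i + j = 0 then 1 else int ((i + j - 1) choose j))"
proof (cases "i + j = 0")
  case False
  then have "int i + int j - 1 = int (i + j - 1)" by linarith
  then show ?thesis using False by (simp only: ibinom_of_nat if_False)
qed (simp add: ibinom_def)

text \<open>The negative binomial series. By Pascal's rule, the backward difference of the coefficients for
  \<open>i + 1\<close> gives the coefficients for \<open>i\<close>, so multiplying the series for \<open>i + 1\<close> by \<open>1 - X\<^sup>M\<close> gives the
  series for \<open>i\<close>; cancelling with \<open>geo_inverse\<close> turns this into the induction step. The convention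
  that \<open>ibinom (-1) 0\<close> is 1 is what makes the case \<open>i = 0\<close> the constant series 1.\<close>

lemma geo_power:
  assumes "M > 0"
  shows "geo M ^ i = gf UNIV (\<lambda>j. ibinom (int i + int j - 1) (int j)) (\<lambda>j. M * j)"
proof (induction i)
  case 0
  show ?case
  proof -
    have "(\<lambda>j. ibinom (int 0 + int j - 1) (int j)) = (\<lambda>j. if j = 0 then 1 else 0)"
      unfolding ibinom_pred by (auto simp: fun_eq_iff)
    then show ?thesis using gf_multiples_delta[OF assms] by (simp only: power_0)
  qed
next
  case (Suc i)
  let ?b = "\<lambda>i j. ibinom (int i + int j - 1) (int j)"
  let ?G = "\<lambda>i. gf UNIV (?b i) (\<lambda>j. M * j)"
  have "?b (Suc i) j - (if j = 0 then 0 else ?b (Suc i) (j - 1)) = ?b i j" for j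
    unfolding ibinom_pred by (cases j; cases i) auto
  then have "(1 - fps_X ^ M) * ?G (Suc i) = ?G i"
    by (simp only: gf_multiples_diff[OF assms])
  then have "geo M * ?G i = ((1 - fps_X ^ M) * geo M) * ?G (Suc i)"
    by (simp only: mult_ac)
  then show ?case
    using Suc assms by (simp add: geo_inverse)
qed

section \<open>Expansions of powers of a finite geometric sum\<close>

text \<open>With \<open>M = m - 1\<close>, the exponent \<open>t\<close> stands for the nonzero residue \<open>t + 1\<close> modulo \<open>m\<close>
  of the difference of two incongruent parts.\<close>

definition residue_poly :: "nat \<Rightarrow> int fps" where
  "residue_poly M = (\<Sum>t<M. fps_X ^ t)"

text \<open>This makes the division in \<open>multinomial\<close> exact.\<close>

lemma prod_fact_dvd_fact: "(\<Prod>x\<leftarrow>is. fact x) dvd (fact (sum_list is) :: nat)"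
proof (induction "is")
  case (Cons a "is")
  have "fact a * (\<Prod>x\<leftarrow>is. fact x) dvd fact a * (fact (sum_list is) :: nat)"
    using Cons by (simp add: mult_dvd_mono)
  also have "\<dots> dvd fact (a + sum_list is)" by (rule fact_fact_dvd_fact)
  finally show ?case by simp
qed simp

lemma multinomial_snoc:
  assumes "a \<le> k" "sum_list is = k - a"
  shows "multinomial k (is @ [a]) = (k choose a) * multinomial (k - a) is"
proof -
  let ?P = "\<Prod>x\<leftarrow>is. fact x :: nat"
  obtain q where q: "fact (k - a) = ?P * q"
    using prod_fact_dvd_fact[of "is"] assms(2) by (auto simp: dvd_def)
  have pos: "?P > 0" by (induction "is") auto
  have "multinomial (k - a) is = q"
    using pos by (simp add: multinomial_def q)
  moreover have "fact k = (fact a * ?P) * ((k choose a) * q)"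
    using binomial_fact_lemma[OF assms(1)] unfolding q by (simp add: mult_ac)
  then have "multinomial k (is @ [a]) = (k choose a) * q"
    using pos by (simp add: multinomial_def mult.commute)
  ultimately show ?thesis by simp
qed

definition weak_compositions :: "nat \<Rightarrow> nat \<Rightarrow> nat list set" where
  "weak_compositions M k = {is. length is = M \<and> sum_list is = k}"

definition index_weight :: "nat list \<Rightarrow> nat" where
  "index_weight is = (\<Sum>t<length is. t * (is ! t))"

lemma finite_weak_compositions: "finite (weak_compositions M k)"
proof (rule finite_subset)
  show "weak_compositions M k \<subseteq> {is. set is \<subseteq> {..k} \<and> length is = M}"
    by (auto simp: weak_compositions_def member_le_sum_list)
qed (simp add: finite_lists_length_eq)

lemma weak_compositions_Suc:
  "bij_betw (\<lambda>(a, is). is @ [a]) (SIGMA a:{..k}. weak_compositions M (k - a))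
     (weak_compositions (Suc M) k)"
  unfolding bij_betw_def
proof
  show "(\<lambda>(a, is). is @ [a]) ` (SIGMA a:{..k}. weak_compositions M (k - a))
      = weak_compositions (Suc M) k"
  proof (intro equalityI subsetI)
    fix js assume js: "js \<in> weak_compositions (Suc M) k"
    then obtain "is" a where "js = is @ [a]"
      by (cases js rule: rev_cases) (auto simp: weak_compositions_def)
    then have "js = (\<lambda>(a, is). is @ [a]) (a, is)"
      "(a, is) \<in> (SIGMA a:{..k}. weak_compositions M (k - a))"
      using js by (auto simp: weak_compositions_def)
    then show "js \<in> (\<lambda>(a, is). is @ [a]) ` (SIGMA a:{..k}. weak_compositions M (k - a))"
      by blast
  qed (auto simp: weak_compositions_def)
qed (auto simp: inj_on_def)

text \<open>The multinomial theorem for the powers of \<open>1 + X + \<dots> + X\<^sup>M\<^sup>-\<^sup>1\<close>. Splitting off the last summand, the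
  binomial theorem sums over its multiplicity \<open>a\<close>, which is the last entry of the list.\<close>

lemma multinomial_gf:
  "gf (weak_compositions M k) (\<lambda>is. int (multinomial k is)) index_weight = residue_poly M ^ k"
proof (induction M arbitrary: k)
  case 0
  have "weak_compositions 0 k = (if k = 0 then {[]} else {})"
    by (auto simp: weak_compositions_def)
  then show ?case
    by (auto simp: gf_finite multinomial_def index_weight_def residue_poly_def power_0_left)
next
  case (Suc M)
  let ?g = "\<lambda>k is. fps_const (int (multinomial k is)) * fps_X ^ index_weight is"
  have IH: "(\<Sum>is\<in>weak_compositions M k. ?g k is) = residue_poly M ^ k" for k
    using Suc by (simp add: gf_finite finite_weak_compositions)
  have step: "?g k (is @ [a]) = of_nat (k choose a) * (fps_X ^ M) ^ a * ?g (k - a) is"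
    if "a \<le> k" "is \<in> weak_compositions M (k - a)" for a "is"
  proof -
    have "index_weight (is @ [a]) = index_weight is + M * a"
      using that by (auto simp: index_weight_def weak_compositions_def nth_append)
    then show ?thesis
      using that multinomial_snoc[of a k "is"]
      by (simp add: weak_compositions_def power_add power_mult fps_of_nat[symmetric]
          fps_const_mult[symmetric] mult_ac del: fps_const_mult)
  qed
  have "gf (weak_compositions (Suc M) k) (\<lambda>is. int (multinomial k is)) index_weight
      = (\<Sum>(a, is)\<in>(SIGMA a:{..k}. weak_compositions M (k - a)). ?g k (is @ [a]))"
    by (simp add: gf_finite finite_weak_compositions
        sum.reindex_bij_betw[OF weak_compositions_Suc, symmetric] case_prod_unfold)
  also have "\<dots> = (\<Sum>a\<le>k. \<Sum>is\<in>weak_compositions M (k - a). ?g k (is @ [a]))"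
    by (rule sum.Sigma[symmetric]) (auto simp: finite_weak_compositions)
  also have "\<dots> = (\<Sum>a\<le>k. \<Sum>is\<in>weak_compositions M (k - a).
      of_nat (k choose a) * (fps_X ^ M) ^ a * ?g (k - a) is)"
    by (intro sum.cong refl step) auto
  also have "\<dots> = (\<Sum>a\<le>k. of_nat (k choose a) * (fps_X ^ M) ^ a * residue_poly M ^ (k - a))"
    by (simp only: sum_distrib_left[symmetric] IH)
  also have "\<dots> = (fps_X ^ M + residue_poly M) ^ k"
    by (rule binomial_ring[symmetric])
  also have "\<dots> = residue_poly (Suc M) ^ k"
    by (simp add: residue_poly_def add.commute)
  finally show ?case .
qed

text \<open>The quotient formula \<open>(1 - X\<^sup>M) / (1 - X)\<close> for the finite geometric sum, raised to the power \<open>k\<close>.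
  For \<open>M = 0\<close> every \<open>r\<close> has weight 0, and the alternating sum of the binomial coefficients is the
  value \<open>0\<^sup>k\<close> of the left-hand side.\<close>

lemma residue_poly_power:
  "residue_poly M ^ k
    = gf {..k} (\<lambda>r. (-1) ^ r * int (k choose r)) (\<lambda>r. M * r) * geo 1 ^ k"
proof -
  have "fps_const ((-1) ^ r) = (-1 :: int fps) ^ r" for r
    by (cases "even r") (auto simp flip: fps_const_neg)
  then have "fps_const ((-1) ^ r * int (k choose r)) * fps_X ^ (M * r)
      = of_nat (k choose r) * (- (fps_X ^ M)) ^ r * 1 ^ (k - r)" for r
    by (simp add: power_minus[of "fps_X ^ M"] power_mult fps_of_nat[symmetric] mult_ac
        flip: fps_const_mult)
  then have "gf {..k} (\<lambda>r. (-1) ^ r * int (k choose r)) (\<lambda>r. M * r)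
      = (\<Sum>r\<le>k. of_nat (k choose r) * (- (fps_X ^ M)) ^ r * 1 ^ (k - r))"
    by (simp only: gf_finite finite_atMost)
  also have "\<dots> = (- (fps_X ^ M) + 1) ^ k"
    by (rule binomial_ring[symmetric])
  also have "- (fps_X ^ M) + 1 = (1 - fps_X) * residue_poly M"
    by (simp add: residue_poly_def one_diff_power_eq)
  finally show ?thesis
    using geo_inverse[of 1] by (simp add: power_mult_distrib[symmetric] mult_ac)
qed

section \<open>Sequences of pairs\<close>

text \<open>The pair \<open>(b, d)\<close> stands for two parts \<open>b\<close> and \<open>b + d\<close>, whose sum is \<open>2 b + d\<close>.\<close>

definition pair_weight :: "nat \<times> nat \<Rightarrow> nat" where
  "pair_weight = (\<lambda>(b, d). 2 * b + d)"

definition congruent_pairs :: "nat \<Rightarrow> (nat \<times> nat) set" where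
  "congruent_pairs m = {(b, d). b > 0 \<and> m dvd d}"

definition incongruent_pairs :: "nat \<Rightarrow> (nat \<times> nat) set" where
  "incongruent_pairs m = {(b, d). b > 0 \<and> \<not> m dvd d}"

lemma congruent_pairs_gf:
  assumes "m > 0"
  shows "finite_fibres (congruent_pairs m) pair_weight"
    and "gf (congruent_pairs m) (\<lambda>_. 1) pair_weight = fps_X ^ 2 * (geo 2 * geo m)"
proof -
  let ?h = "\<lambda>(u, q). (u + 1 :: nat, m * q)"
  let ?w = "\<lambda>(u, q). 2 * u + m * q"
  have bij: "bij_betw ?h (UNIV \<times> UNIV) (congruent_pairs m)"
    unfolding bij_betw_def
  proof
    show "inj_on ?h (UNIV \<times> UNIV)" using assms by (auto simp: inj_on_def)
    show "?h ` (UNIV \<times> UNIV) = congruent_pairs m"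
    proof (intro equalityI subsetI)
      fix p assume "p \<in> congruent_pairs m"
      then obtain b q where "p = (b, m * q)" "b > 0"
        by (auto simp: congruent_pairs_def dvd_def)
      then have "p = ?h (b - 1, q)" by simp
      then show "p \<in> ?h ` (UNIV \<times> UNIV)" by blast
    qed (auto simp: congruent_pairs_def)
  qed
  have w: "pair_weight (?h p) = ?w p + 2" for p
    by (auto simp: pair_weight_def split: prod.splits)
  have fin: "finite_fibres (UNIV \<times> UNIV) ?w"
    using assms by (intro finite_fibres_Times finite_fibres_mult) auto
  show "finite_fibres (congruent_pairs m) pair_weight"
    using finite_fibres_reindex[OF bij w finite_fibres_shift[OF fin]] .
  have "gf (congruent_pairs m) (\<lambda>_. 1) pair_weight
      = gf (UNIV \<times> UNIV) (\<lambda>(u, q). 1 * 1) (\<lambda>p. ?w p + 2)"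
    using bij w by (rule gf_reindex) auto
  also have "\<dots> = fps_X ^ 2 * (geo 2 * geo m)"
    using assms unfolding gf_shift geo_def
    by (subst gf_Times) (auto intro: finite_fibres_mult)
  finally show "gf (congruent_pairs m) (\<lambda>_. 1) pair_weight = fps_X ^ 2 * (geo 2 * geo m)" .
qed

text \<open>A difference \<open>d\<close> not divisible by \<open>m\<close> is uniquely \<open>m q + (t + 1)\<close> with \<open>t < m - 1\<close>. The exponent 3 is
  the 2 from \<open>b = u + 1\<close> plus the 1 from \<open>t + 1\<close>.\<close>

lemma incongruent_pairs_gf:
  assumes "m > 0"
  shows "finite_fibres (incongruent_pairs m) pair_weight"
    and "gf (incongruent_pairs m) (\<lambda>_. 1) pair_weight
      = fps_X ^ 3 * (residue_poly (m - 1) * (geo 2 * geo m))"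
proof -
  let ?T = "{..<m - 1} \<times> (UNIV \<times> UNIV) :: (nat \<times> nat \<times> nat) set"
  let ?h = "\<lambda>(t, u, q). (u + 1 :: nat, m * q + (t + 1))"
  let ?v = "\<lambda>(u, q). 2 * u + m * q"
  let ?w = "\<lambda>(t, p). t + ?v p"
  have bij: "bij_betw ?h ?T (incongruent_pairs m)"
    unfolding bij_betw_def
  proof
    show "inj_on ?h ?T"
    proof (rule inj_onI)
      fix x y assume xy: "x \<in> ?T" "y \<in> ?T" "?h x = ?h y"
      obtain t u q t' u' q' where x: "x = (t, u, q)" and y: "y = (t', u', q')"
        by (cases x, cases y) auto
      have t: "t < m - 1" "t' < m - 1"
        using xy(1,2) unfolding x y by simp_all
      have eq: "u = u'" "m * q + (t + 1) = m * q' + (t' + 1)"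
        using xy(3) unfolding x y prod.case prod.inject by (simp_all only: add_right_cancel)
      have "t + 1 = (m * q + (t + 1)) mod m" using t(1) by simp
      also have "\<dots> = t' + 1" unfolding eq(2) using t(2) by simp
      finally have "t = t'" by (simp only: add_right_cancel)
      then have "m * q = m * q'" using eq(2) by (simp only: add_right_cancel)
      then show "x = y" using \<open>t = t'\<close> eq(1) assms by (simp add: x y)
    qed
    show "?h ` ?T = incongruent_pairs m"
    proof (intro equalityI subsetI)
      fix p assume "p \<in> ?h ` ?T"
      then obtain t u q where p: "p = (u + 1, m * q + (t + 1))" "t < m - 1" by auto
      then have "(m * q + (t + 1)) mod m = t + 1" by simp
      then have "\<not> m dvd m * q + (t + 1)" by (simp only: dvd_eq_mod_eq_0)
      then show "p \<in> incongruent_pairs m" using p by (simp add: incongruent_pairs_def)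
    next
      fix p assume "p \<in> incongruent_pairs m"
      then obtain b d where p: "p = (b, d)" "b > 0" "d mod m \<noteq> 0"
        by (auto simp: incongruent_pairs_def dvd_eq_mod_eq_0)
      then have "p = ?h (d mod m - 1, b - 1, d div m)"
        using mult_div_mod_eq[of m d] by (simp del: mult_div_mod_eq)
      moreover have "d mod m - 1 < m - 1"
        using assms p(3) mod_less_divisor[of m d] by linarith
      ultimately show "p \<in> ?h ` ?T" by blast
    qed
  qed
  have w: "pair_weight (?h p) = ?w p + 3" for p
    by (cases p) (simp add: pair_weight_def)
  have fin': "finite_fibres (UNIV \<times> UNIV) ?v"
    using assms by (intro finite_fibres_Times finite_fibres_mult) auto
  have fin: "finite_fibres ?T ?w"
    by (rule finite_fibres_Times[OF finite_fibres_finite[OF finite_lessThan] fin'])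
  show "finite_fibres (incongruent_pairs m) pair_weight"
    using finite_fibres_reindex[OF bij w finite_fibres_shift[OF fin]] .
  have "gf (incongruent_pairs m) (\<lambda>_. 1) pair_weight
      = gf ?T (\<lambda>(t, p). 1 * (case p of (u, q) \<Rightarrow> 1 * 1)) (\<lambda>p. ?w p + 3)"
    using bij w by (rule gf_reindex) auto
  also have "\<dots> = fps_X ^ 3 * (gf {..<m - 1} (\<lambda>_. 1) (\<lambda>t. t)
      * gf (UNIV \<times> UNIV) (\<lambda>(u, q). 1 * 1) ?v)"
    unfolding gf_shift gf_Times[OF finite_fibres_finite[OF finite_lessThan] fin'] ..
  also have "gf (UNIV \<times> UNIV) (\<lambda>(u, q). 1 * 1) ?v = geo 2 * geo m"
    using assms unfolding geo_def
    by (subst gf_Times) (auto intro: finite_fibres_mult)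
  finally show "gf (incongruent_pairs m) (\<lambda>_. 1) pair_weight
      = fps_X ^ 3 * (residue_poly (m - 1) * (geo 2 * geo m))"
    by (simp add: gf_finite residue_poly_def)
qed

definition pair_lists :: "nat \<Rightarrow> nat \<Rightarrow> nat \<Rightarrow> (nat \<times> nat) list set" where
  "pair_lists m k i = {ps. length ps = i \<and> (\<forall>(b, d)\<in>set ps. b > 0)
     \<and> length (filter (\<lambda>(b, d). \<not> m dvd d) ps) = k}"

definition list_weight :: "(nat \<times> nat) list \<Rightarrow> nat" where
  "list_weight ps = sum_list (map pair_weight ps)"

lemma pair_lists_Suc:
  "pair_lists m k (Suc i) =
     (\<lambda>(p, ps). p # ps) ` (congruent_pairs m \<times> pair_lists m k i) \<union>
     (\<lambda>(p, ps). p # ps) `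
       (if k = 0 then {} else incongruent_pairs m \<times> pair_lists m (k - 1) i)"
  (is "_ = ?h ` ?A \<union> ?h ` ?B")
proof (intro equalityI subsetI)
  fix ps assume "ps \<in> pair_lists m k (Suc i)"
  then obtain p qs where "ps = p # qs" "p # qs \<in> pair_lists m k (Suc i)"
    by (auto simp: pair_lists_def length_Suc_conv)
  then have "ps = ?h (p, qs)" "(p, qs) \<in> ?A \<union> ?B"
    by (auto simp: pair_lists_def congruent_pairs_def incongruent_pairs_def split: if_splits)
  then show "ps \<in> ?h ` ?A \<union> ?h ` ?B" by blast
qed (auto simp: pair_lists_def congruent_pairs_def incongruent_pairs_def split: if_splits)

lemma gf_image_Cons:
  assumes "finite_fibres A pair_weight" "finite_fibres B list_weight"
  shows "finite_fibres ((\<lambda>(p, ps). p # ps) ` (A \<times> B)) list_weight"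
    and "gf ((\<lambda>(p, ps). p # ps) ` (A \<times> B)) (\<lambda>_. 1) list_weight
      = gf A (\<lambda>_. 1) pair_weight * gf B (\<lambda>_. 1) list_weight"
proof -
  let ?h = "\<lambda>(p, ps). p # ps"
  let ?w = "\<lambda>(p, ps). pair_weight p + list_weight ps"
  have bij: "bij_betw ?h (A \<times> B) (?h ` (A \<times> B))"
    by (auto simp: bij_betw_def inj_on_def)
  have w: "list_weight (?h x) = ?w x" for x
    by (auto simp: list_weight_def split: prod.splits)
  show "finite_fibres (?h ` (A \<times> B)) list_weight"
    by (rule finite_fibres_reindex[OF bij w finite_fibres_Times[OF assms]])
  have "gf (?h ` (A \<times> B)) (\<lambda>_. 1) list_weight = gf (A \<times> B) (\<lambda>(p, ps). 1 * 1) ?w"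
    using bij w by (rule gf_reindex) auto
  also have "\<dots> = gf A (\<lambda>_. 1) pair_weight * gf B (\<lambda>_. 1) list_weight"
    by (rule gf_Times[OF assms])
  finally show "gf (?h ` (A \<times> B)) (\<lambda>_. 1) list_weight
      = gf A (\<lambda>_. 1) pair_weight * gf B (\<lambda>_. 1) list_weight" .
qed

text \<open>Prepending a pair that is congruent or incongruent reproduces Pascal's rule for \<open>i choose k\<close>; an
  incongruent pair differs from a congruent one by the additional factor \<open>X\<close> times
  \<open>residue_poly (m - 1)\<close>.\<close>

lemma pair_lists_gf:
  assumes "m > 0"
  shows "finite_fibres (pair_lists m k i) list_weight
    \<and> gf (pair_lists m k i) (\<lambda>_. 1) list_weight
      = of_nat (i choose k) * fps_X ^ (2 * i + k) * (geo 2 * geo m) ^ i * residue_poly (m - 1) ^ k"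
proof (induction i arbitrary: k)
  case 0
  have "pair_lists m k 0 = (if k = 0 then {[]} else {})"
    by (auto simp: pair_lists_def)
  then show ?case
    by (auto simp: gf_finite list_weight_def finite_fibres_def)
next
  case (Suc i)
  let ?h = "\<lambda>(p, ps). p # ps"
  let ?P = "geo 2 * geo m" and ?U = "residue_poly (m - 1)"
  have A: "finite_fibres (?h ` (congruent_pairs m \<times> pair_lists m k i)) list_weight"
      "gf (?h ` (congruent_pairs m \<times> pair_lists m k i)) (\<lambda>_. 1) list_weight
       = (fps_X ^ 2 * ?P) * (of_nat (i choose k) * fps_X ^ (2 * i + k) * ?P ^ i * ?U ^ k)" for k
    using gf_image_Cons[OF congruent_pairs_gf(1)[OF assms] Suc.IH[of k, THEN conjunct1]]
      congruent_pairs_gf(2)[OF assms] Suc.IH[of k] by simp_all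
  show ?case
  proof (cases k)
    case 0
    then show ?thesis
      unfolding pair_lists_Suc using A[of 0] by (simp add: mult_ac power_add power2_eq_square)
  next
    case (Suc l)
    have B: "finite_fibres (?h ` (incongruent_pairs m \<times> pair_lists m l i)) list_weight"
      "gf (?h ` (incongruent_pairs m \<times> pair_lists m l i)) (\<lambda>_. 1) list_weight
       = (fps_X ^ 3 * (?U * ?P)) * (of_nat (i choose l) * fps_X ^ (2 * i + l) * ?P ^ i * ?U ^ l)"
      using gf_image_Cons[OF incongruent_pairs_gf(1)[OF assms] Suc.IH[of l, THEN conjunct1]]
        incongruent_pairs_gf(2)[OF assms] Suc.IH[of l] by simp_all
    have disj: "?h ` (congruent_pairs m \<times> pair_lists m k i)
        \<inter> ?h ` (incongruent_pairs m \<times> pair_lists m l i) = {}"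
      by (auto simp: congruent_pairs_def incongruent_pairs_def)
    have "gf (pair_lists m k (Suc i)) (\<lambda>_. 1) list_weight =
        (fps_X ^ 2 * ?P) * (of_nat (i choose k) * fps_X ^ (2 * i + k) * ?P ^ i * ?U ^ k) +
        (fps_X ^ 3 * (?U * ?P)) * (of_nat (i choose l) * fps_X ^ (2 * i + l) * ?P ^ i * ?U ^ l)"
      unfolding pair_lists_Suc using gf_Un[OF A(1)[of k] B(1) disj] A(2)[of k] B(2) \<open>k = Suc l\<close>
      by simp
    also have "\<dots> = of_nat (Suc i choose k) * fps_X ^ (2 * Suc i + k) * ?P ^ Suc i * ?U ^ k"
      unfolding \<open>k = Suc l\<close>
      by (simp add: power_add power2_eq_square power3_eq_cube algebra_simps)
    finally show ?thesis
      using finite_fibres_Un[OF A(1)[of k] B(1)] \<open>k = Suc l\<close> by (simp add: pair_lists_Suc)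
  qed
qed

section \<open>Compositions up to swaps\<close>

text \<open>Together, \<open>folded\<close> and \<open>middle\<close> form a complete invariant of the swap class of a composition. The value 0 of \<open>middle\<close> encodes the absence of a middle part; it cannot
  be confused with an actual part, since parts are positive.\<close>

definition folded :: "nat list \<Rightarrow> (nat \<times> nat) list" where
  "folded \<alpha> = map (\<lambda>j. let x = \<alpha> ! j; y = \<alpha> ! (length \<alpha> - 1 - j)
      in (min x y, max x y - min x y)) [0..<length \<alpha> div 2]"

definition middle :: "nat list \<Rightarrow> nat" where
  "middle \<alpha> = (if odd (length \<alpha>) then \<alpha> ! (length \<alpha> div 2) else 0)"

lemma length_folded [simp]: "length (folded \<alpha>) = length \<alpha> div 2"
  by (simp add: folded_def)

lemma folded_nth:
  "j < length \<alpha> div 2 \<Longrightarrow> folded \<alpha> ! j =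
     (min (\<alpha> ! j) (\<alpha> ! (length \<alpha> - 1 - j)),
      max (\<alpha> ! j) (\<alpha> ! (length \<alpha> - 1 - j)) - min (\<alpha> ! j) (\<alpha> ! (length \<alpha> - 1 - j)))"
  by (simp add: folded_def Let_def)

lemma min_diff_eq_iff:
  fixes x y x' y' :: nat
  shows "(min x y, max x y - min x y) = (min x' y', max x' y' - min x' y')
    \<longleftrightarrow> (x = x' \<and> y = y') \<or> (x = y' \<and> y = x')"
  by (auto simp: min_def max_def)

lemma swap_stepE:
  assumes "(\<alpha>, \<beta>) \<in> swap_step"
  obtains j where "j < length \<alpha> div 2"
    "\<beta> = \<alpha>[j := \<alpha> ! (length \<alpha> - 1 - j), length \<alpha> - 1 - j := \<alpha> ! j]"
proof -
  from assms obtain i where i: "1 \<le> i" "2 * i \<le> length \<alpha>" "\<beta> = swap_parts i \<alpha>"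
    by (auto simp: swap_step_def)
  then have j: "i - 1 < length \<alpha> div 2" by linarith
  have mirror: "length \<alpha> + 1 - i - 1 = length \<alpha> - 1 - (i - 1)"
    using i(1) by linarith
  show ?thesis
    by (rule that[OF j]) (simp only: i(3) swap_parts_def Let_def Defs.part_def mirror)
qed

lemma swap_stepI:
  assumes "j < length \<alpha> div 2"
  shows "(\<alpha>, \<alpha>[j := \<alpha> ! (length \<alpha> - 1 - j), length \<alpha> - 1 - j := \<alpha> ! j]) \<in> swap_step"
proof -
  have "1 \<le> Suc j" "2 * Suc j \<le> length \<alpha>" using assms by auto
  moreover have "swap_parts (Suc j) \<alpha>
      = \<alpha>[j := \<alpha> ! (length \<alpha> - 1 - j), length \<alpha> - 1 - j := \<alpha> ! j]"
    by (simp add: swap_parts_def Defs.part_def Let_def)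
  ultimately show ?thesis unfolding swap_step_def by (metis (mono_tags, lifting) mem_Collect_eq)
qed

lemma swap_step_invariant:
  assumes "(\<alpha>, \<beta>) \<in> swap_step"
  shows "length \<beta> = length \<alpha>" "folded \<beta> = folded \<alpha>" "middle \<beta> = middle \<alpha>"
proof -
  obtain j where j: "j < length \<alpha> div 2"
    and b: "\<beta> = \<alpha>[j := \<alpha> ! (length \<alpha> - 1 - j), length \<alpha> - 1 - j := \<alpha> ! j]"
    using assms by (rule swap_stepE)
  show len: "length \<beta> = length \<alpha>" by (simp add: b)
  show "middle \<beta> = middle \<alpha>"
    unfolding middle_def len using j by (auto simp: b nth_list_update elim!: oddE)
  have "folded \<beta> ! i = folded \<alpha> ! i" if "i < length \<alpha> div 2" for i
    using that j unfolding folded_nth[OF that] folded_nth[of i \<beta>, unfolded len, OF that]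
    by (cases "i = j") (auto simp: b nth_list_update min.commute max.commute)
  then show "folded \<beta> = folded \<alpha>"
    by (intro nth_equalityI) (auto simp: len)
qed

lemma swap_equiv_invariant:
  assumes "(\<alpha>, \<beta>) \<in> swap_equiv"
  shows "length \<beta> = length \<alpha> \<and> folded \<beta> = folded \<alpha> \<and> middle \<beta> = middle \<alpha>"
  using assms unfolding swap_equiv_def
  by (induction rule: rtrancl_induct) (auto dest: swap_step_invariant)

lemma index_in_half_or_middle:
  fixes j l :: nat
  assumes "j < l"
  shows "j < l div 2 \<or> l - 1 - j < l div 2 \<or> (odd l \<and> j = l div 2)"
  using assms by presburger

text \<open>Starting from \<open>\<alpha>\<close>, the mirror pairs are brought into agreement with \<open>\<beta>\<close> from the outside inwards.
  Since \<open>\<gamma>\<close> and \<open>\<beta>\<close> have the same unordered pair at \<open>h\<close>, either they agree there already or one swap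
  at \<open>h\<close> makes them agree, and this swap leaves the outer pairs alone.\<close>

lemma swap_equivI:
  assumes len: "length \<alpha> = length \<beta>" and fld: "folded \<alpha> = folded \<beta>"
    and mid: "middle \<alpha> = middle \<beta>"
  shows "(\<alpha>, \<beta>) \<in> swap_equiv"
proof -
  let ?l = "length \<beta>"
  have "\<exists>\<gamma>. (\<alpha>, \<gamma>) \<in> swap_equiv \<and> (\<forall>j<h. \<gamma> ! j = \<beta> ! j \<and> \<gamma> ! (?l - 1 - j) = \<beta> ! (?l - 1 - j))"
    if "h \<le> ?l div 2" for h
    using that
  proof (induction h)
    case 0
    show ?case by (auto simp: swap_equiv_def)
  next
    case (Suc h)
    then obtain \<gamma> where \<gamma>: "(\<alpha>, \<gamma>) \<in> swap_equiv"
      "\<And>j. j < h \<Longrightarrow> \<gamma> ! j = \<beta> ! j \<and> \<gamma> ! (?l - 1 - j) = \<beta> ! (?l - 1 - j)"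
      by auto
    from swap_equiv_invariant[OF \<gamma>(1)] len fld
    have lg: "length \<gamma> = ?l" and fg: "folded \<gamma> = folded \<beta>" by auto
    have h: "h < ?l div 2" using Suc.prems by simp
    have "folded \<gamma> ! h = folded \<beta> ! h" by (simp add: fg)
    then consider "\<gamma> ! h = \<beta> ! h" "\<gamma> ! (?l - 1 - h) = \<beta> ! (?l - 1 - h)"
      | "\<gamma> ! h = \<beta> ! (?l - 1 - h)" "\<gamma> ! (?l - 1 - h) = \<beta> ! h"
      using folded_nth[of h \<gamma>] folded_nth[of h \<beta>] h
      unfolding lg by (metis min_diff_eq_iff)
    then show ?case
    proof cases
      case 1
      then show ?thesis using \<gamma> by (metis less_Suc_eq)
    next
      case 2
      let ?\<delta> = "\<gamma>[h := \<gamma> ! (?l - 1 - h), ?l - 1 - h := \<gamma> ! h]"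
      have "(\<gamma>, ?\<delta>) \<in> swap_step" using swap_stepI[of h \<gamma>] h by (simp add: lg)
      then have "(\<alpha>, ?\<delta>) \<in> swap_equiv"
        using \<gamma>(1) by (simp add: swap_equiv_def)
      moreover have "?\<delta> ! j = \<beta> ! j \<and> ?\<delta> ! (?l - 1 - j) = \<beta> ! (?l - 1 - j)" if "j < Suc h" for j
        using that h 2 \<gamma>(2)[of j] lg
        by (cases "j = h") (auto simp: nth_list_update)
      ultimately show ?thesis by blast
    qed
  qed
  from this[of "?l div 2"] obtain \<gamma> where \<gamma>: "(\<alpha>, \<gamma>) \<in> swap_equiv"
    "\<And>j. j < ?l div 2 \<Longrightarrow> \<gamma> ! j = \<beta> ! j \<and> \<gamma> ! (?l - 1 - j) = \<beta> ! (?l - 1 - j)"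
    by auto
  from swap_equiv_invariant[OF \<gamma>(1)] len mid
  have lg: "length \<gamma> = ?l" and mg: "middle \<gamma> = middle \<beta>" by auto
  have "\<gamma> = \<beta>"
  proof (rule nth_equalityI)
    fix j assume j: "j < length \<gamma>"
    consider "j < ?l div 2" | "?l - 1 - j < ?l div 2" | "odd ?l" "j = ?l div 2"
      using index_in_half_or_middle[of j ?l] j lg by auto
    then show "\<gamma> ! j = \<beta> ! j"
    proof cases
      case 2
      then show ?thesis using \<gamma>(2)[of "?l - 1 - j"] j lg by auto
    next
      case 3
      then show ?thesis using mg lg by (simp add: middle_def)
    qed (use \<gamma>(2) in blast)
  qed (rule lg)
  then show ?thesis using \<gamma>(1) by simp
qed

lemma sum_list_folded: "sum_list \<alpha> = list_weight (folded \<alpha>) + middle \<alpha>"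
proof -
  let ?l = "length \<alpha>"
  let ?h = "?l div 2"
  let ?mir = "\<lambda>j. ?l - 1 - j"
  have idx: "{0..<?l} = {..<?h} \<union> (?mir ` {..<?h} \<union> (if odd ?l then {?h} else {}))"
  proof (intro equalityI subsetI)
    fix j assume j: "j \<in> {0..<?l}"
    then have "j = ?mir (?mir j)" by auto
    moreover have "j < ?h \<or> ?mir j < ?h \<or> (odd ?l \<and> j = ?h)"
      using index_in_half_or_middle[of j ?l] j by auto
    ultimately show "j \<in> {..<?h} \<union> (?mir ` {..<?h} \<union> (if odd ?l then {?h} else {}))"
      by auto
  qed (auto split: if_splits elim!: oddE)
  have d1: "{..<?h} \<inter> (?mir ` {..<?h} \<union> (if odd ?l then {?h} else {})) = {}"
    by auto
  have d2: "?mir ` {..<?h} \<inter> (if odd ?l then {?h} else {}) = {}"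
    by (auto elim!: oddE)
  have "sum_list \<alpha> = (\<Sum>j\<in>{0..<?l}. \<alpha> ! j)" by (rule sum_list_sum_nth)
  also have "\<dots> = (\<Sum>j<?h. \<alpha> ! j) + ((\<Sum>j\<in>?mir ` {..<?h}. \<alpha> ! j) + middle \<alpha>)"
    unfolding idx using d1 d2
    by (subst sum.union_disjoint; (subst sum.union_disjoint)?) (auto simp: middle_def)
  also have "(\<Sum>j\<in>?mir ` {..<?h}. \<alpha> ! j) = (\<Sum>j<?h. \<alpha> ! ?mir j)"
    by (subst sum.reindex) (auto simp: inj_on_def)
  also have "(\<Sum>j<?h. \<alpha> ! j) + ((\<Sum>j<?h. \<alpha> ! ?mir j) + middle \<alpha>)
      = (\<Sum>j<?h. \<alpha> ! j + \<alpha> ! ?mir j) + middle \<alpha>"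
    by (simp add: sum.distrib)
  also have "(\<Sum>j<?h. \<alpha> ! j + \<alpha> ! ?mir j) = (\<Sum>j<?h. pair_weight (folded \<alpha> ! j))"
    by (rule sum.cong) (auto simp: folded_nth pair_weight_def min_def max_def)
  also have "\<dots> = list_weight (folded \<alpha>)"
    by (simp add: list_weight_def sum_list_sum_nth atLeast0LessThan)
  finally show ?thesis .
qed

lemma dvd_max_minus_min_iff:
  fixes x y :: nat
  shows "m dvd max x y - min x y \<longleftrightarrow> x mod m = y mod m"
  using mod_eq_dvd_iff_nat[of x y m] mod_eq_dvd_iff_nat[of y x m]
  by (cases "x \<le> y") (simp_all add: max_def min_def eq_commute)

lemma num_incongruent_pairs_folded:
  "num_incongruent_pairs m \<alpha> = length (filter (\<lambda>(b, d). \<not> m dvd d) (folded \<alpha>))"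
proof -
  let ?J = "{j. j < length (folded \<alpha>) \<and> (case folded \<alpha> ! j of (b, d) \<Rightarrow> \<not> m dvd d)}"
  let ?I = "{i. 1 \<le> i \<and> 2 * i \<le> length \<alpha> \<and>
              Defs.part \<alpha> i mod m \<noteq> Defs.part \<alpha> (length \<alpha> + 1 - i) mod m}"
  have iff: "j \<in> ?J \<longleftrightarrow> Suc j \<in> ?I" for j
    by (auto simp: folded_nth Defs.part_def dvd_max_minus_min_iff)
  have "Suc ` ?J = ?I"
  proof (intro equalityI subsetI)
    fix i assume i: "i \<in> ?I"
    then obtain j where "i = Suc j" by (cases i) auto
    then have "j \<in> ?J" using i iff[of j] by (simp only:)
    then show "i \<in> Suc ` ?J" unfolding \<open>i = Suc j\<close> by (rule imageI)
  next
    fix i assume "i \<in> Suc ` ?J"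
    then obtain j where "i = Suc j" "j \<in> ?J" by (rule imageE)
    then show "i \<in> ?I" using iff[of j] by (simp only:)
  qed
  moreover have "card (Suc ` ?J) = card ?J" by (rule card_image) (rule inj_Suc)
  ultimately have "card ?I = card ?J" by (simp only:)
  then show ?thesis
    unfolding num_incongruent_pairs_def length_filter_conv_card .
qed

definition admissible :: "nat \<Rightarrow> nat \<Rightarrow> nat \<Rightarrow> nat list set" where
  "admissible m k n = {\<alpha> \<in> compositions n. num_incongruent_pairs m \<alpha> = k \<and>
     (even (length \<alpha>) \<or> odd (length \<alpha>) \<and> even (Defs.part \<alpha> ((length \<alpha> + 1) div 2)))}"

lemma admissible_iff:
  "\<alpha> \<in> admissible m k n \<longleftrightarrow> (\<forall>a\<in>set \<alpha>. a > 0) \<and> even (middle \<alpha>)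
     \<and> list_weight (folded \<alpha>) + middle \<alpha> = n
     \<and> length (filter (\<lambda>(b, d). \<not> m dvd d) (folded \<alpha>)) = k"
proof -
  have "odd (length \<alpha>) \<Longrightarrow> Defs.part \<alpha> ((length \<alpha> + 1) div 2) = \<alpha> ! (length \<alpha> div 2)"
    by (auto simp: Defs.part_def elim!: oddE)
  then show ?thesis
    by (auto simp: admissible_def compositions_def num_incongruent_pairs_folded
        sum_list_folded middle_def)
qed

text \<open>A right inverse of \<open>(folded, middle)\<close>: the composition with the smaller part of each pair in the
  first half.\<close>

definition unfolded :: "(nat \<times> nat) list \<Rightarrow> nat \<Rightarrow> nat list" where
  "unfolded ps e = map fst ps @ (if e = 0 then [] else [e]) @ rev (map (\<lambda>(b, d). b + d) ps)"

lemma unfolded: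
  "folded (unfolded ps e) = ps" "middle (unfolded ps e) = e"
proof -
  have len: "length (unfolded ps e) = 2 * length ps + (if e = 0 then 0 else 1)"
    by (simp add: unfolded_def)
  show "middle (unfolded ps e) = e"
    unfolding middle_def len by (auto simp: unfolded_def nth_append)
  show "folded (unfolded ps e) = ps"
  proof (rule nth_equalityI)
    show lf: "length (folded (unfolded ps e)) = length ps"
      by (simp add: len)
    fix j assume "j < length (folded (unfolded ps e))"
    then have j: "j < length ps" by (simp only: lf)
    obtain b d where bd: "ps ! j = (b, d)" by (cases "ps ! j")
    have "unfolded ps e ! j = b"
      using j bd by (simp add: unfolded_def nth_append)
    moreover have "unfolded ps e ! (length (unfolded ps e) - 1 - j) = b + d"
      unfolding len using j bd
      by (auto simp: unfolded_def nth_append rev_nth)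
    ultimately show "folded (unfolded ps e) ! j = ps ! j"
      using j bd by (subst folded_nth) (auto simp: len)
  qed
qed

definition fold_forms :: "nat \<Rightarrow> nat \<Rightarrow> nat \<Rightarrow> ((nat \<times> nat) list \<times> nat) set" where
  "fold_forms m k n = {(ps, e). (\<forall>(b, d)\<in>set ps. b > 0) \<and> even e \<and> list_weight ps + e = n
     \<and> length (filter (\<lambda>(b, d). \<not> m dvd d) ps) = k}"

lemma image_admissible: "(\<lambda>\<alpha>. (folded \<alpha>, middle \<alpha>)) ` admissible m k n = fold_forms m k n"
proof (intro equalityI subsetI)
  fix x assume "x \<in> (\<lambda>\<alpha>. (folded \<alpha>, middle \<alpha>)) ` admissible m k n"
  then obtain \<alpha> where \<alpha>: "\<alpha> \<in> admissible m k n" "x = (folded \<alpha>, middle \<alpha>)" by auto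
  have "b > 0" if bd: "(b, d) \<in> set (folded \<alpha>)" for b d
  proof -
    obtain j where j: "j < length \<alpha> div 2" "folded \<alpha> ! j = (b, d)"
      using bd by (auto simp: in_set_conv_nth)
    then have "\<alpha> ! j \<in> set \<alpha>" "\<alpha> ! (length \<alpha> - 1 - j) \<in> set \<alpha>" by auto
    then show ?thesis
      using j \<alpha>(1) by (auto simp: folded_nth admissible_iff)
  qed
  then show "x \<in> fold_forms m k n"
    using \<alpha> by (auto simp: fold_forms_def admissible_iff)
next
  fix x assume "x \<in> fold_forms m k n"
  moreover obtain ps e where "x = (ps, e)" by (cases x)
  ultimately have x: "x = (ps, e)" "(ps, e) \<in> fold_forms m k n" by simp_all
  then have "\<forall>p\<in>set ps. fst p > 0"
    by (simp add: fold_forms_def case_prod_unfold)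
  then have "\<forall>a\<in>set (unfolded ps e). a > 0"
    by (auto simp: unfolded_def case_prod_unfold)
  then have "unfolded ps e \<in> admissible m k n"
    using x(2) by (simp add: admissible_iff unfolded fold_forms_def)
  then show "x \<in> (\<lambda>\<alpha>. (folded \<alpha>, middle \<alpha>)) ` admissible m k n"
    by (rule rev_image_eqI) (simp only: x(1) unfolded)
qed

lemma swap_class_eq_iff:
  assumes "\<alpha> \<in> admissible m k n" "\<beta> \<in> admissible m k n"
  shows "swap_equiv `` {\<alpha>} = swap_equiv `` {\<beta>}
    \<longleftrightarrow> (folded \<alpha>, middle \<alpha>) = (folded \<beta>, middle \<beta>)"
proof
  assume "swap_equiv `` {\<alpha>} = swap_equiv `` {\<beta>}"
  moreover have "(\<beta>, \<beta>) \<in> swap_equiv" by (simp add: swap_equiv_def)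
  ultimately have "(\<alpha>, \<beta>) \<in> swap_equiv" by blast
  then show "(folded \<alpha>, middle \<alpha>) = (folded \<beta>, middle \<beta>)"
    using swap_equiv_invariant by auto
next
  assume eq: "(folded \<alpha>, middle \<alpha>) = (folded \<beta>, middle \<beta>)"
  \<comment> \<open>Parts are positive, so the invariant also determines the length.\<close>
  have len: "length \<gamma> = 2 * length (folded \<gamma>) + (if middle \<gamma> = 0 then 0 else 1)"
    if "\<gamma> \<in> admissible m k n" for \<gamma>
  proof (cases "odd (length \<gamma>)")
    case True
    then have "\<gamma> ! (length \<gamma> div 2) \<in> set \<gamma>" by (auto elim!: oddE)
    then have "middle \<gamma> > 0" using that True by (simp add: admissible_iff middle_def)
    then show ?thesis using True by (auto elim!: oddE)
  qed (simp add: middle_def)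
  from eq have fm: "folded \<alpha> = folded \<beta>" "middle \<alpha> = middle \<beta>" by simp_all
  have "length \<alpha> = 2 * length (folded \<alpha>) + (if middle \<alpha> = 0 then 0 else 1)"
    by (rule len[OF assms(1)])
  also have "\<dots> = length \<beta>"
    by (simp only: fm len[OF assms(2), symmetric])
  finally have "(\<alpha>, \<beta>) \<in> swap_equiv" "(\<beta>, \<alpha>) \<in> swap_equiv"
    using eq by (auto intro: swap_equivI)
  then show "swap_equiv `` {\<alpha>} = swap_equiv `` {\<beta>}"
    unfolding swap_equiv_def by (auto intro: rtrancl_trans)
qed

lemma card_image_eq_if_same_kernel:
  assumes "\<And>x y. x \<in> A \<Longrightarrow> y \<in> A \<Longrightarrow> f x = f y \<longleftrightarrow> g x = g y"
  shows "card (f ` A) = card (g ` A)"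
proof -
  have *: "f (inv_into A g (g x)) = f x" "inv_into A g (g x) \<in> A" if "x \<in> A" for x
    using assms[of "inv_into A g (g x)" x] that
    by (auto simp: inv_into_into f_inv_into_f)
  have "bij_betw (\<lambda>z. f (inv_into A g z)) (g ` A) (f ` A)"
    unfolding bij_betw_def
  proof
    show "inj_on (\<lambda>z. f (inv_into A g z)) (g ` A)"
      using * assms by (auto simp: inj_on_def)
    show "(\<lambda>z. f (inv_into A g z)) ` g ` A = f ` A"
      unfolding image_image using * by simp
  qed
  then show ?thesis by (simp add: bij_betw_same_card)
qed

lemma rpc_plus_eq_card_fold_forms: "rpc_plus k n m = card (fold_forms m k n)"
proof -
  have "rpc_plus k n m = card (admissible m k n // swap_equiv)"
    by (simp add: rpc_plus_def admissible_def)
  also have "admissible m k n // swap_equiv = (\<lambda>\<alpha>. swap_equiv `` {\<alpha>}) ` admissible m k n"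
    by (auto simp: quotient_def)
  also have "card \<dots> = card ((\<lambda>\<alpha>. (folded \<alpha>, middle \<alpha>)) ` admissible m k n)"
    by (rule card_image_eq_if_same_kernel) (rule swap_class_eq_iff)
  finally show ?thesis by (simp only: image_admissible)
qed

section \<open>The two formulas\<close>

text \<open>This bounds the number of pairs, which makes the sum over \<open>i\<close> finite.\<close>

lemma length_le_list_weight:
  "\<forall>(b, d)\<in>set ps. b > 0 \<Longrightarrow> length ps \<le> list_weight ps"
  by (induction ps) (auto simp: list_weight_def pair_weight_def)

lemma rpc_plus_eq_coeffs:
  assumes "m > 0"
  shows "int (rpc_plus k n m) = (\<Sum>i\<le>n. fps_nth
    (of_nat (i choose k) * fps_X ^ (2 * i + k) *
      (geo m ^ i * (geo 2 ^ Suc i * residue_poly (m - 1) ^ k))) n)"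
proof -
  let ?w = "\<lambda>(ps, c). list_weight ps + 2 * c"
  let ?F = "\<lambda>i. {x \<in> pair_lists m k i \<times> UNIV. ?w x = n}"
  have ff: "finite_fibres (pair_lists m k i) list_weight" for i
    using pair_lists_gf[OF assms] by blast
  have fin: "finite (?F i)" for i
    using finite_fibres_Times[OF ff finite_fibres_mult[of 2]]
    by (simp add: finite_fibres_def)
  have coeff: "int (card (?F i)) = fps_nth
    (of_nat (i choose k) * fps_X ^ (2 * i + k) *
      (geo m ^ i * (geo 2 ^ Suc i * residue_poly (m - 1) ^ k))) n" for i
  proof -
    have "int (card (?F i)) = fps_nth (gf (pair_lists m k i \<times> UNIV) (\<lambda>(ps, c). 1 * 1) ?w) n"
      by (simp add: gf_nth case_prod_unfold)
    also have "gf (pair_lists m k i \<times> UNIV) (\<lambda>(ps, c). 1 * 1) ?w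
        = gf (pair_lists m k i) (\<lambda>_. 1) list_weight * geo 2"
      unfolding geo_def by (rule gf_Times[OF ff finite_fibres_mult]) simp
    also have "\<dots> = of_nat (i choose k) * fps_X ^ (2 * i + k) *
        (geo m ^ i * (geo 2 ^ Suc i * residue_poly (m - 1) ^ k))"
      using pair_lists_gf[OF assms, of k i] by (simp add: power_mult_distrib mult_ac)
    finally show ?thesis .
  qed
  have "bij_betw (\<lambda>(ps, c). (ps, 2 * c)) (\<Union>i\<in>{..n}. ?F i) (fold_forms m k n)"
    unfolding bij_betw_def
  proof
    show "(\<lambda>(ps, c). (ps, 2 * c)) ` (\<Union>i\<in>{..n}. ?F i) = fold_forms m k n"
    proof (intro equalityI subsetI)
      fix x assume "x \<in> fold_forms m k n"
      moreover obtain ps e where "x = (ps, e)" by (cases x)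
      moreover from calculation obtain c where "e = 2 * c"
        by (auto simp: fold_forms_def elim: evenE)
      ultimately have x: "x = (ps, 2 * c)" "(ps, 2 * c) \<in> fold_forms m k n" by simp_all
      then have "length ps \<le> n"
        using length_le_list_weight[of ps] by (auto simp: fold_forms_def)
      then have "(ps, c) \<in> (\<Union>i\<in>{..n}. ?F i)"
        using x(2) by (auto simp: fold_forms_def pair_lists_def)
      then show "x \<in> (\<lambda>(ps, c). (ps, 2 * c)) ` (\<Union>i\<in>{..n}. ?F i)"
        by (rule rev_image_eqI) (simp add: x(1))
    qed (auto simp: fold_forms_def pair_lists_def)
  qed (auto simp: inj_on_def)
  then have "rpc_plus k n m = card (\<Union>i\<in>{..n}. ?F i)"
    by (simp add: rpc_plus_eq_card_fold_forms bij_betw_same_card)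
  also have "\<dots> = (\<Sum>i\<le>n. card (?F i))"
    by (rule card_UN_disjoint) (use fin in \<open>auto simp: pair_lists_def\<close>)
  finally show ?thesis by (simp add: coeff)
qed

text \<open>The factor \<open>X\<^sup>2\<^sup>i\<^sup>+\<^sup>k\<close> restricts \<open>i\<close> to \<open>i \<le> n\<close>, and finite fibres do the rest, so that the sum has
  finite support.\<close>

lemma Sum_any_eq_coeffs:
  assumes "finite_fibres S w"
  shows "Sum_any (\<lambda>(i, x). if x \<in> S \<and> 2 * i + k + w x = n then int (i choose k) * f i x else 0)
    = (\<Sum>i\<le>n. fps_nth (of_nat (i choose k) * fps_X ^ (2 * i + k) * gf S (f i) w) n)"
proof -
  let ?A = "\<lambda>i. {x \<in> S. 2 * i + k + w x = n}"
  let ?g = "\<lambda>(i, x). if x \<in> S \<and> 2 * i + k + w x = n then int (i choose k) * f i x else 0"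
  have A: "?A i = (if n < 2 * i + k then {} else {x \<in> S. w x = n - (2 * i + k)})" for i
    by auto
  then have fin: "finite (?A i)" for i
    using assms by (simp add: finite_fibres_def)
  have "Sum_any ?g = sum ?g (SIGMA i:{..n}. ?A i)"
    by (rule Sum_any.expand_superset) (use fin in \<open>auto split: if_splits\<close>)
  also have "\<dots> = (\<Sum>i\<le>n. \<Sum>x\<in>?A i. int (i choose k) * f i x)"
    by (subst sum.Sigma) (use fin in \<open>auto intro!: sum.cong\<close>)
  also have "\<dots> = (\<Sum>i\<le>n. fps_nth (of_nat (i choose k) * (fps_X ^ (2 * i + k) * gf S (f i) w)) n)"
  proof (rule sum.cong[OF refl])
    fix i
    have "fps_nth (of_nat (i choose k) * (fps_X ^ (2 * i + k) * gf S (f i) w)) n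
      = int (i choose k) * fps_nth (fps_X ^ (2 * i + k) * gf S (f i) w) n"
      unfolding fps_of_nat[symmetric] by (rule fps_mult_left_const_nth)
    also have "\<dots> = int (i choose k) * (\<Sum>x\<in>?A i. f i x)"
      unfolding A by (simp add: fps_X_power_mult_nth gf_nth)
    finally show "(\<Sum>x\<in>?A i. int (i choose k) * f i x)
      = fps_nth (of_nat (i choose k) * (fps_X ^ (2 * i + k) * gf S (f i) w)) n"
      by (simp add: sum_distrib_left)
  qed
  finally show ?thesis by (simp only: mult.assoc)
qed

text \<open>The common part of both formulas. The sum over \<open>c\<close> comes from \<open>geo 2 ^ Suc i\<close>, one factor for each
  pair and one for the middle part, whence \<open>i + c\<close> instead of \<open>i + c - 1\<close> in its binomial
  coefficient.\<close>

lemma rpc_plus_eq_Sum_any: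
  fixes S :: "'a set"
  assumes m: "m > 0" and S: "finite_fibres S w"
    and gf: "gf S f w = residue_poly (m - 1) ^ k"
  shows "int (rpc_plus k n m) = Sum_any (\<lambda>(i, j, c, x).
      if x \<in> S \<and> 2 * i + m * j + 2 * c + w x + k = n
      then ibinom (int i) (int k) * ibinom (int i + int j - 1) (int j)
         * ibinom (int i + int c) (int c) * f x else 0)"
proof -
  let ?S = "UNIV \<times> UNIV \<times> S :: (nat \<times> nat \<times> 'a) set"
  let ?v = "\<lambda>(c, x). 2 * c + w x"
  let ?w = "\<lambda>(j, y). m * j + ?v y"
  let ?f = "\<lambda>i (j, y). ibinom (int i + int j - 1) (int j) *
    (case y of (c, x) \<Rightarrow> ibinom (int (Suc i) + int c - 1) (int c) * f x)"
  have fin': "finite_fibres (UNIV \<times> S) ?v"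
    by (intro finite_fibres_Times S finite_fibres_mult) simp
  have fin: "finite_fibres ?S ?w"
    by (intro finite_fibres_Times fin' finite_fibres_mult m)
  have "gf ?S (?f i) ?w = geo m ^ i * (geo 2 ^ Suc i * residue_poly (m - 1) ^ k)" for i
    unfolding gf_Times[OF finite_fibres_mult[OF m] fin'] geo_power[OF m]
      gf_Times[OF finite_fibres_mult[OF zero_less_numeral] S] geo_power[OF zero_less_numeral] gf ..
  then have "int (rpc_plus k n m) = Sum_any (\<lambda>(i, x).
      if x \<in> ?S \<and> 2 * i + k + ?w x = n then int (i choose k) * ?f i x else 0)"
    by (simp only: rpc_plus_eq_coeffs[OF m] Sum_any_eq_coeffs[OF fin])
  also have "(\<lambda>(i, x). if x \<in> ?S \<and> 2 * i + k + ?w x = n then int (i choose k) * ?f i x else 0)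
    = (\<lambda>(i, j, c, x). if x \<in> S \<and> 2 * i + m * j + 2 * c + w x + k = n
      then ibinom (int i) (int k) * ibinom (int i + int j - 1) (int j)
         * ibinom (int i + int c) (int c) * f x else 0)"
    by (rule ext) (auto simp: ibinom_of_nat mult_ac add_ac split: prod.splits)
  finally show ?thesis .
qed

theorem theorem5p1:
  fixes m n k :: nat
  assumes "m \<ge> 1"
  shows
    "int (rpc_plus k n m) =
       Sum_any (\<lambda>(i :: nat, j :: nat, c :: nat, r :: nat, s :: nat).
         if 2 * int i + int m * int j + 2 * int c + (int m - 1) * int r + int s = int n - int k
         then (-1) ^ r * ibinom (int i) (int k) * ibinom (int i + int j - 1) (int j)
                * ibinom (int i + int c) (int c) * ibinom (int k) (int r)
                * ibinom (int k + int s - 1) (int s)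
         else 0)
     \<and>
     int (rpc_plus k n m) =
       Sum_any (\<lambda>(i :: nat, j :: nat, c :: nat, is :: nat list).
         if length is = m - 1 \<and> sum_list is = k \<and>
            2 * int i + int m * int j + 2 * int c + (\<Sum>t<m - 1. int t * int (is ! t)) = int n - int k
         then ibinom (int i) (int k) * ibinom (int i + int j - 1) (int j)
                * ibinom (int i + int c) (int c) * int (multinomial k is)
         else 0)"
proof
  have m: "m > 0" and m1: "int m - 1 = int (m - 1)" using assms by auto
  \<comment> \<open>Bounding \<open>r\<close> by \<open>k\<close> loses no terms, as \<open>ibinom k r\<close> is 0 beyond; it keeps the fibres finite
    also for \<open>m = 1\<close>, where \<open>r\<close> does not contribute to the weight.\<close>
  let ?S = "{..k} \<times> UNIV :: (nat \<times> nat) set"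
  let ?w = "\<lambda>(r, s). (m - 1) * r + 1 * s"
  let ?f = "\<lambda>(r, s). ((-1) ^ r * int (k choose r)) * ibinom (int k + int s - 1) (int s)"
  have fin: "finite_fibres {..k} (\<lambda>r. (m - 1) * r)" "finite_fibres UNIV (\<lambda>s. 1 * s)"
    by (simp_all only: finite_fibres_finite finite_atMost finite_fibres_mult zero_less_one)
  have "gf ?S ?f ?w = residue_poly (m - 1) ^ k"
    unfolding gf_Times[OF fin] residue_poly_power geo_power[OF zero_less_one] ..
  note sum_eq = rpc_plus_eq_Sum_any[OF m finite_fibres_Times[OF fin] this]
  have "2 * int i + int m * int j + 2 * int c + (int m - 1) * int r + int s = int n - int k
    \<longleftrightarrow> int (2 * i + m * j + 2 * c + ((m - 1) * r + 1 * s) + k) = int n" for i j c r s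
    unfolding m1 by simp linarith
  then have iff: "2 * int i + int m * int j + 2 * int c + (int m - 1) * int r + int s
      = int n - int k
    \<longleftrightarrow> 2 * i + m * j + 2 * c + ((m - 1) * r + 1 * s) + k = n" for i j c r s
    by (simp only: of_nat_eq_iff)
  have summand: "(if (r, s) \<in> ?S \<and> 2 * i + m * j + 2 * c + ((m - 1) * r + 1 * s) + k = n
       then ibinom (int i) (int k) * ibinom (int i + int j - 1) (int j)
         * ibinom (int i + int c) (int c)
         * (((-1) ^ r * int (k choose r)) * ibinom (int k + int s - 1) (int s)) else 0)
    = (if 2 * int i + int m * int j + 2 * int c + (int m - 1) * int r + int s = int n - int k
       then (-1) ^ r * ibinom (int i) (int k) * ibinom (int i + int j - 1) (int j)
         * ibinom (int i + int c) (int c) * ibinom (int k) (int r)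
         * ibinom (int k + int s - 1) (int s)
       else 0)" for i j c r s
    unfolding iff ibinom_of_nat[of k r] by (cases "r \<le> k") (simp_all add: mult_ac)
  show "int (rpc_plus k n m) =
       Sum_any (\<lambda>(i :: nat, j :: nat, c :: nat, r :: nat, s :: nat).
         if 2 * int i + int m * int j + 2 * int c + (int m - 1) * int r + int s = int n - int k
         then (-1) ^ r * ibinom (int i) (int k) * ibinom (int i + int j - 1) (int j)
                * ibinom (int i + int c) (int c) * ibinom (int k) (int r)
                * ibinom (int k + int s - 1) (int s)
         else 0)"
    by (rule trans[OF sum_eq])
      (intro arg_cong[where f = Sum_any] ext, simp only: split_paired_all prod.case summand)
next
  have m: "m > 0" using assms by simp
  let ?S = "weak_compositions (m - 1) k"
  note sum_eq =
    rpc_plus_eq_Sum_any[OF m finite_fibres_finite[OF finite_weak_compositions] multinomial_gf]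
  have "2 * int i + int m * int j + 2 * int c + (\<Sum>t<m - 1. int t * int (is ! t)) = int n - int k
    \<longleftrightarrow> int (2 * i + m * j + 2 * c + index_weight is + k) = int n"
    if "length is = m - 1" for i j c "is"
    unfolding index_weight_def that by simp linarith
  then have index: "is \<in> ?S \<and> 2 * i + m * j + 2 * c + index_weight is + k = n
    \<longleftrightarrow> length is = m - 1 \<and> sum_list is = k \<and>
      2 * int i + int m * int j + 2 * int c + (\<Sum>t<m - 1. int t * int (is ! t)) = int n - int k"
    for i j c "is"
    unfolding weak_compositions_def by (auto simp only: of_nat_eq_iff mem_Collect_eq)
  show "int (rpc_plus k n m) =
       Sum_any (\<lambda>(i :: nat, j :: nat, c :: nat, is :: nat list).
         if length is = m - 1 \<and> sum_list is = k \<and>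
            2 * int i + int m * int j + 2 * int c + (\<Sum>t<m - 1. int t * int (is ! t)) = int n - int k
         then ibinom (int i) (int k) * ibinom (int i + int j - 1) (int j)
                * ibinom (int i + int c) (int c) * int (multinomial k is)
         else 0)"
    by (rule trans[OF sum_eq])
      (intro arg_cong[where f = Sum_any] ext, simp only: split_paired_all prod.case index)
qed

end
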